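(* (Embedding-immersion amalgamation.) Let $L$ be a first-order language, let $A,B$ be two $L$-structures and let $C$ be a model of $T_i(A)$. Let $e:A\to B$ be an embedding and let $i:A\to C$ be the natural immersion (sending each $a\in A$ to the interpretation in $C$ of the constant $a$). Then there exist a model $D$ of $T_i(B)$, an embedding $e':C\to D$ and an immersion $i':B\to D$ such that $i'\circ e=e'\circ i$.
   Context: Positive formulas are those obtained from atomic formulas (including equalities and $\bot$) using $\wedge,\vee,\exists$. An h-inductive sentence is a finite conjunction of sentences $\forall\bar x\,(\exists\bar y\,\psi(\bar x,\bar y)\rightarrow\exists\bar z\,\varphi(\bar x,\bar z))$ with $\psi,\varphi$ positive quantifier-free. A map $h:A\to B$ of $L$-structures is an embedding if for every atomic $L$-formula $\phi$ and every tuple $\bar a$ from $A$, $A\models\phi(\bar a)$ iff $B\models\phi(h(\bar a))$; it is an immersion if for every tuple $\bar a$ from $A$, $\bar a$ and $h(\bar a)$ satisfy the same positive $L$-formulas. For an $L$-structure $A$, $L(A)$ is $L$ expanded by the elements of $A$ as constants, and $T_i(A)$ is the set of h-inductive $L(A)$-sentences satisfied by $A$. *)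

theory Defs
  imports Main
begin

section \<open>Languages and formulas\<close>

text \<open>The symbols are sets, not whole types, so that a language may have no function symbols or
  no relation symbols. Constants are the function symbols of arity 0.\<close>

record ('f, 'r) language =
  funs :: "'f set"
  rels :: "'r set"
  farity :: "'f \<Rightarrow> nat"
  rarity :: "'r \<Rightarrow> nat"

datatype 'f trm = Var nat | Fun 'f "'f trm list"

datatype ('f, 'r) fm =
    Bot
  | Eq "'f trm" "'f trm"
  | Rel 'r "'f trm list"
  | Conj "('f, 'r) fm" "('f, 'r) fm"
  | Disj "('f, 'r) fm" "('f, 'r) fm"
  | Imp "('f, 'r) fm" "('f, 'r) fm"
  | Ex nat "('f, 'r) fm"
  | All nat "('f, 'r) fm"

fun wf_trm :: "('f, 'r) language \<Rightarrow> 'f trm \<Rightarrow> bool" where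
  "wf_trm L (Var n) \<longleftrightarrow> True"
| "wf_trm L (Fun f ts) \<longleftrightarrow> f \<in> funs L \<and> length ts = farity L f \<and> (\<forall>t\<in>set ts. wf_trm L t)"

fun wf_fm :: "('f, 'r) language \<Rightarrow> ('f, 'r) fm \<Rightarrow> bool" where
  "wf_fm L Bot \<longleftrightarrow> True"
| "wf_fm L (Eq s t) \<longleftrightarrow> wf_trm L s \<and> wf_trm L t"
| "wf_fm L (Rel r ts) \<longleftrightarrow> r \<in> rels L \<and> length ts = rarity L r \<and> (\<forall>t\<in>set ts. wf_trm L t)"
| "wf_fm L (Conj p q) \<longleftrightarrow> wf_fm L p \<and> wf_fm L q"
| "wf_fm L (Disj p q) \<longleftrightarrow> wf_fm L p \<and> wf_fm L q"
| "wf_fm L (Imp p q) \<longleftrightarrow> wf_fm L p \<and> wf_fm L q"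
| "wf_fm L (Ex n p) \<longleftrightarrow> wf_fm L p"
| "wf_fm L (All n p) \<longleftrightarrow> wf_fm L p"

fun fv_trm :: "'f trm \<Rightarrow> nat set" where
  "fv_trm (Var n) = {n}"
| "fv_trm (Fun f ts) = (\<Union>t\<in>set ts. fv_trm t)"

fun fv :: "('f, 'r) fm \<Rightarrow> nat set" where
  "fv Bot = {}"
| "fv (Eq s t) = fv_trm s \<union> fv_trm t"
| "fv (Rel r ts) = (\<Union>t\<in>set ts. fv_trm t)"
| "fv (Conj p q) = fv p \<union> fv q"
| "fv (Disj p q) = fv p \<union> fv q"
| "fv (Imp p q) = fv p \<union> fv q"
| "fv (Ex n p) = fv p - {n}"
| "fv (All n p) = fv p - {n}"

fun atomic :: "('f, 'r) fm \<Rightarrow> bool" where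
  "atomic Bot \<longleftrightarrow> True"
| "atomic (Eq s t) \<longleftrightarrow> True"
| "atomic (Rel r ts) \<longleftrightarrow> True"
| "atomic _ \<longleftrightarrow> False"

inductive positive :: "('f, 'r) fm \<Rightarrow> bool" where
  "atomic p \<Longrightarrow> positive p"
| "positive p \<Longrightarrow> positive q \<Longrightarrow> positive (Conj p q)"
| "positive p \<Longrightarrow> positive q \<Longrightarrow> positive (Disj p q)"
| "positive p \<Longrightarrow> positive (Ex n p)"

fun quantifier_free :: "('f, 'r) fm \<Rightarrow> bool" where
  "quantifier_free (Conj p q) \<longleftrightarrow> quantifier_free p \<and> quantifier_free q"
| "quantifier_free (Disj p q) \<longleftrightarrow> quantifier_free p \<and> quantifier_free q"
| "quantifier_free (Imp p q) \<longleftrightarrow> quantifier_free p \<and> quantifier_free q"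
| "quantifier_free (Ex n p) \<longleftrightarrow> False"
| "quantifier_free (All n p) \<longleftrightarrow> False"
| "quantifier_free _ \<longleftrightarrow> True"

abbreviation exs :: "nat list \<Rightarrow> ('f, 'r) fm \<Rightarrow> ('f, 'r) fm" where
  "exs ns p \<equiv> foldr Ex ns p"

abbreviation alls :: "nat list \<Rightarrow> ('f, 'r) fm \<Rightarrow> ('f, 'r) fm" where
  "alls ns p \<equiv> foldr All ns p"

inductive h_inductive :: "('f, 'r) language \<Rightarrow> ('f, 'r) fm \<Rightarrow> bool" for L where
  basic:
    "\<lbrakk> distinct (xs @ ys); distinct (xs @ zs);
       wf_fm L \<psi>; positive \<psi>; quantifier_free \<psi>; fv \<psi> \<subseteq> set (xs @ ys);
       wf_fm L \<phi>; positive \<phi>; quantifier_free \<phi>; fv \<phi> \<subseteq> set (xs @ zs) \<rbrakk>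
     \<Longrightarrow> h_inductive L (alls xs (Imp (exs ys \<psi>) (exs zs \<phi>)))"
| conj: "h_inductive L p \<Longrightarrow> h_inductive L q \<Longrightarrow> h_inductive L (Conj p q)"

section \<open>Structures\<close>

record ('f, 'r, 'm) struct =
  univ :: "'m set"
  fun_of :: "'f \<Rightarrow> 'm list \<Rightarrow> 'm"
  rel_of :: "'r \<Rightarrow> 'm list \<Rightarrow> bool"

definition is_struct :: "('f, 'r) language \<Rightarrow> ('f, 'r, 'm) struct \<Rightarrow> bool" where
  "is_struct L M \<longleftrightarrow> univ M \<noteq> {} \<and>
     (\<forall>f\<in>funs L. \<forall>xs. set xs \<subseteq> univ M \<longrightarrow> length xs = farity L f \<longrightarrow> fun_of M f xs \<in> univ M)"

fun eval :: "('f, 'r, 'm) struct \<Rightarrow> (nat \<Rightarrow> 'm) \<Rightarrow> 'f trm \<Rightarrow> 'm" where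
  "eval M v (Var n) = v n"
| "eval M v (Fun f ts) = fun_of M f (map (eval M v) ts)"

fun sat :: "('f, 'r, 'm) struct \<Rightarrow> (nat \<Rightarrow> 'm) \<Rightarrow> ('f, 'r) fm \<Rightarrow> bool" where
  "sat M v Bot \<longleftrightarrow> False"
| "sat M v (Eq s t) \<longleftrightarrow> eval M v s = eval M v t"
| "sat M v (Rel r ts) \<longleftrightarrow> rel_of M r (map (eval M v) ts)"
| "sat M v (Conj p q) \<longleftrightarrow> sat M v p \<and> sat M v q"
| "sat M v (Disj p q) \<longleftrightarrow> sat M v p \<or> sat M v q"
| "sat M v (Imp p q) \<longleftrightarrow> (sat M v p \<longrightarrow> sat M v q)"
| "sat M v (Ex n p) \<longleftrightarrow> (\<exists>x\<in>univ M. sat M (v(n := x)) p)"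
| "sat M v (All n p) \<longleftrightarrow> (\<forall>x\<in>univ M. sat M (v(n := x)) p)"

text \<open>Intended for sentences, whose truth does not depend on the assignment; an assignment into the
  universe exists because universes are nonempty.\<close>

definition satisfies :: "('f, 'r, 'm) struct \<Rightarrow> ('f, 'r) fm \<Rightarrow> bool" where
  "satisfies M p \<longleftrightarrow> (\<forall>v. range v \<subseteq> univ M \<longrightarrow> sat M v p)"

definition is_model ::
    "('f, 'r) language \<Rightarrow> ('f, 'r) fm set \<Rightarrow> ('f, 'r, 'm) struct \<Rightarrow> bool" where
  "is_model L T M \<longleftrightarrow> is_struct L M \<and> (\<forall>p\<in>T. satisfies M p)"

text \<open>A tuple from \<open>A\<close> is the restriction of an assignment \<open>v\<close> into \<open>A\<close> to the free variables of the
  formula.\<close>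

definition embedding ::
    "('f, 'r) language \<Rightarrow> ('f, 'r, 'a) struct \<Rightarrow> ('f, 'r, 'b) struct \<Rightarrow> ('a \<Rightarrow> 'b) \<Rightarrow> bool" where
  "embedding L A B h \<longleftrightarrow> h ` univ A \<subseteq> univ B \<and>
     (\<forall>p v. wf_fm L p \<longrightarrow> atomic p \<longrightarrow> range v \<subseteq> univ A \<longrightarrow> (sat A v p \<longleftrightarrow> sat B (h \<circ> v) p))"

definition immersion ::
    "('f, 'r) language \<Rightarrow> ('f, 'r, 'a) struct \<Rightarrow> ('f, 'r, 'b) struct \<Rightarrow> ('a \<Rightarrow> 'b) \<Rightarrow> bool" where
  "immersion L A B h \<longleftrightarrow> h ` univ A \<subseteq> univ B \<and>
     (\<forall>p v. wf_fm L p \<longrightarrow> positive p \<longrightarrow> range v \<subseteq> univ A \<longrightarrow> (sat A v p \<longleftrightarrow> sat B (h \<circ> v) p))"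

section \<open>Expansion by constants\<close>

definition expand_lang ::
    "('f, 'r) language \<Rightarrow> ('f, 'r, 'a) struct \<Rightarrow> ('f + 'a, 'r) language" where
  "expand_lang L A =
     \<lparr> funs = Inl ` funs L \<union> Inr ` univ A, rels = rels L,
       farity = case_sum (farity L) (\<lambda>_. 0), rarity = rarity L \<rparr>"

definition expand_struct :: "('f, 'r, 'a) struct \<Rightarrow> ('f + 'a, 'r, 'a) struct" where
  "expand_struct A =
     \<lparr> univ = univ A, fun_of = case_sum (fun_of A) (\<lambda>a _. a), rel_of = rel_of A \<rparr>"

definition reduct :: "('f + 'a, 'r, 'm) struct \<Rightarrow> ('f, 'r, 'm) struct" where
  "reduct M = \<lparr> univ = univ M, fun_of = (\<lambda>f. fun_of M (Inl f)), rel_of = rel_of M \<rparr>"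

definition natural_map :: "('f + 'a, 'r, 'm) struct \<Rightarrow> 'a \<Rightarrow> 'm" where
  "natural_map M a = fun_of M (Inr a) []"

definition T_i :: "('f, 'r) language \<Rightarrow> ('f, 'r, 'a) struct \<Rightarrow> ('f + 'a, 'r) fm set" where
  "T_i L A = {p. h_inductive (expand_lang L A) p \<and> satisfies (expand_struct A) p}"

text \<open>HOL cannot quantify existentially over types, so a structure claimed to exist needs a type for
  its elements that is fixed in advance. This one is large enough for the elements of an ultrapower
  of a structure on \<open>'b\<close> with the maps \<open>'c \<Rightarrow> 'b\<close> as index set; the universe itself may be any
  nonempty subset.\<close>

type_synonym ('b, 'c) amalgam = "(('c \<Rightarrow> 'b) \<Rightarrow> 'b) set"

end

theory Submission
  imports Defs
begin

text \<open>
  The amalgam \<open>D\<close> is an ultrapower of \<open>B\<close>, with \<open>i'\<close> the diagonal map, and \<open>e'\<close> is read off from the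
  index set: an index is a map \<open>s\<close> from the elements of \<open>C\<close> to those of \<open>B\<close>, and \<open>e'\<close> sends \<open>c\<close> to the
  class of the function \<open>s \<mapsto> s c\<close>. By the theorem of Los (\<open>Los\<close>) \<open>D\<close> satisfies every
  sentence with parameters from \<open>B\<close> that holds in \<open>B\<close>, so it is a model of \<open>T\<^sub>i(B)\<close>, and the
  diagonal map preserves and reflects all formulas, in particular the positive ones.

  The other two requirements are met by the choice of the ultrafilter. The map \<open>e'\<close> is an embedding
  if, for each atomic formula \<open>p\<close> and each tuple \<open>v\<close> from \<open>C\<close>, almost every \<open>s\<close> satisfies
  \<open>C \<Turnstile> p(v) \<longleftrightarrow> B \<Turnstile> p(s v)\<close>; and \<open>i' \<circ> e = e' \<circ> i\<close> holds if for each \<open>a\<close> from \<open>A\<close> almost every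
  \<open>s\<close> sends \<open>i a\<close> to \<open>e a\<close>. An ultrafilter with all these properties exists as soon as any finitely
  many of them hold together for some \<open>s\<close> (\<open>ultra_extending_subbase\<close>).

  Finitely many of them constrain a finite tuple of elements of \<open>C\<close>. The truth values of the atomic
  formulas in question at this tuple, together with the equations that name its elements of the form
  \<open>i a\<close>, are a finite set \<open>P\<close> of true atomic formulas and a finite set \<open>Q\<close> of false ones, all with
  parameters from \<open>A\<close>. Hence \<open>C\<close> violates \<open>\<forall>x. \<And>P(x) \<longrightarrow> \<Or>Q(x)\<close>. This sentence is h-inductive over
  \<open>L(A)\<close>, so \<open>A\<close> violates it too, because \<open>C\<close> is a model of \<open>T\<^sub>i(A)\<close>. A tuple of \<open>A\<close> that witnesses
  this gives a map \<open>w\<close> from \<open>C\<close> to \<open>A\<close> with the required behaviour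
  (\<open>finite_diagram_realised\<close>), and since \<open>e\<close> preserves and reflects atomic formulas, \<open>s = e \<circ> w\<close> is
  as desired.
\<close>

section \<open>Ultrafilters\<close>

definition ultra :: "'i filter \<Rightarrow> bool" where
  "ultra U \<longleftrightarrow> U \<noteq> bot \<and> (\<forall>P. eventually P U \<or> eventually (\<lambda>s. \<not> P s) U)"

lemma ultra_eventually_not:
  assumes "ultra U"
  shows "eventually (\<lambda>s. \<not> P s) U \<longleftrightarrow> \<not> eventually P U"
proof
  assume "eventually (\<lambda>s. \<not> P s) U"
  then show "\<not> eventually P U"
    using assms eventually_conj[of P U "\<lambda>s. \<not> P s"]
    by (auto simp: ultra_def)
qed (use assms in \<open>auto simp: ultra_def\<close>)

lemma ultra_eventually_disj:
  assumes "ultra U"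
  shows "eventually (\<lambda>s. P s \<or> Q s) U \<longleftrightarrow> eventually P U \<or> eventually Q U"
proof -
  have "eventually (\<lambda>s. P s \<or> Q s) U \<longleftrightarrow> \<not> eventually (\<lambda>s. \<not> P s \<and> \<not> Q s) U"
    using ultra_eventually_not[OF assms, of "\<lambda>s. P s \<or> Q s"] by simp
  then show ?thesis
    by (simp add: eventually_conj_iff ultra_eventually_not[OF assms])
qed

lemma ultra_eventually_imp:
  assumes "ultra U"
  shows "eventually (\<lambda>s. P s \<longrightarrow> Q s) U \<longleftrightarrow> (eventually P U \<longrightarrow> eventually Q U)"
  unfolding imp_conv_disj ultra_eventually_disj[OF assms] ultra_eventually_not[OF assms] ..

text \<open>A witness for a bounded existential quantifier can be chosen separately at each index; this is
  the step of Los's theorem for \<open>\<exists>\<close>. The step for \<open>\<forall>\<close> is its dual, so it requires an ultrafilter.\<close>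

lemma eventually_bex_iff:
  assumes "X \<noteq> {}"
  shows "eventually (\<lambda>s. \<exists>x\<in>X. P s x) U
    \<longleftrightarrow> (\<exists>h. range h \<subseteq> X \<and> eventually (\<lambda>s. P s (h s)) U)"
proof
  have "\<forall>s. \<exists>x\<in>X. (\<exists>x\<in>X. P s x) \<longrightarrow> P s x" using assms by blast
  then obtain h where h: "\<And>s. h s \<in> X" "\<And>s. \<exists>x\<in>X. P s x \<Longrightarrow> P s (h s)" by metis
  assume "eventually (\<lambda>s. \<exists>x\<in>X. P s x) U"
  then have "eventually (\<lambda>s. P s (h s)) U" by (rule eventually_mono) (rule h(2))
  with h(1) show "\<exists>h. range h \<subseteq> X \<and> eventually (\<lambda>s. P s (h s)) U" by blast
next
  assume "\<exists>h. range h \<subseteq> X \<and> eventually (\<lambda>s. P s (h s)) U"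
  then show "eventually (\<lambda>s. \<exists>x\<in>X. P s x) U" by (auto elim!: eventually_mono)
qed

lemma ultra_eventually_ball_iff:
  assumes "ultra U" "X \<noteq> {}"
  shows "eventually (\<lambda>s. \<forall>x\<in>X. P s x) U
    \<longleftrightarrow> (\<forall>h. range h \<subseteq> X \<longrightarrow> eventually (\<lambda>s. P s (h s)) U)"
  using eventually_bex_iff[OF assms(2), of "\<lambda>s x. \<not> P s x" U]
    ultra_eventually_not[OF assms(1)]
    ultra_eventually_not[OF assms(1), of "\<lambda>s. \<forall>x\<in>X. P s x"]
  by auto

text \<open>A minimal proper filter below \<open>F\<close>, which exists by Zorn's lemma, is an ultrafilter: if it does
  not make \<open>P\<close> fail almost everywhere, then restricting it to \<open>P\<close> leaves it proper, hence unchanged.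
  In the lattice of filters, smaller means more sets.\<close>

lemma ultra_below_filter:
  fixes F :: "'i filter"
  assumes "F \<noteq> bot"
  shows "\<exists>U. ultra U \<and> U \<le> F"
proof -
  define N where "N = {G. G \<noteq> bot \<and> G \<le> F}"
  have "\<exists>U\<in>N. \<forall>G\<in>N. G \<le> U \<longrightarrow> G = U"
  proof (rule predicate_Zorn)
    show "partial_order_on N (relation_of (\<lambda>G H. H \<le> G) N)"
      by (rule partial_order_on_relation_ofI) auto
  next
    fix K assume K: "K \<in> Chains (relation_of (\<lambda>G H. H \<le> G) N)"
    have KN: "K \<subseteq> N" and chain: "\<And>G H. G \<in> K \<Longrightarrow> H \<in> K \<Longrightarrow> G \<le> H \<or> H \<le> G"
      using K by (auto simp: Chains_def relation_of_def)
    show "\<exists>u\<in>N. \<forall>G\<in>K. u \<le> G"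
    proof (cases "K = {}")
      case True
      then show ?thesis using assms by (auto simp: N_def)
    next
      case False
      have "Inf K \<noteq> bot"
      proof -
        have "\<exists>I\<in>K. I \<le> inf G H" if "G \<in> K" "H \<in> K" for G H
          using chain[OF that] that by (metis inf.absorb1 inf.absorb2 order_refl)
        then have "eventually P (Inf K) \<longleftrightarrow> (\<exists>G\<in>K. eventually P G)" for P
          using False by (intro eventually_Inf_base) auto
        then show ?thesis
          using KN by (auto simp: N_def simp flip: eventually_False)
      qed
      moreover have "Inf K \<le> F"
        using KN False by (auto simp: N_def intro: Inf_lower2)
      ultimately show ?thesis by (auto simp: N_def intro: Inf_lower)
    qed
  qed
  then obtain U where U: "U \<noteq> bot" "U \<le> F"
    and minimal: "\<And>G. G \<noteq> bot \<Longrightarrow> G \<le> U \<Longrightarrow> G = U"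
    by (auto simp: N_def intro: order_trans)
  have "eventually P U \<or> eventually (\<lambda>s. \<not> P s) U" for P
  proof (cases "inf U (principal {s. P s}) = bot")
    case True
    then show ?thesis by (simp add: eventually_inf_principal flip: eventually_False)
  next
    case False
    then have "inf U (principal {s. P s}) = U" by (intro minimal) auto
    then have "U \<le> principal {s. P s}" by (metis inf.cobounded2)
    then show ?thesis by (simp add: le_principal)
  qed
  then show ?thesis using U by (auto simp: ultra_def)
qed

lemma ultra_extending_subbase:
  assumes "\<And>\<X>. \<X> \<subseteq> \<S> \<Longrightarrow> finite \<X> \<Longrightarrow> \<Inter>\<X> \<noteq> {}"
  shows "\<exists>U. ultra U \<and> (\<forall>X\<in>\<S>. eventually (\<lambda>s. s \<in> X) U)"
proof -
  have "Inf (principal ` \<S>) \<noteq> bot"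
  proof (rule Inf_filter_not_bot)
    fix Y assume "Y \<subseteq> principal ` \<S>" "finite Y"
    then obtain \<X> where "\<X> \<subseteq> \<S>" "finite \<X>" "Y = principal ` \<X>"
      by (meson finite_subset_image)
    then show "Inf Y \<noteq> bot"
      using assms[of \<X>] INF_principal_finite[of \<X> "\<lambda>X. X"]
      by (simp add: principal_eq_bot_iff)
  qed
  then obtain U where U: "ultra U" "U \<le> Inf (principal ` \<S>)"
    using ultra_below_filter by blast
  have "eventually (\<lambda>s. s \<in> X) U" if "X \<in> \<S>" for X
  proof -
    have "U \<le> principal X" using U(2) that by (meson Inf_lower image_eqI order_trans)
    then show ?thesis by (simp add: le_principal)
  qed
  then show ?thesis using U(1) by blast
qed

section \<open>Ultrapowers\<close>

text \<open>Only functions into \<open>X\<close> are members, so that representatives have all their values in the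
  universe of the structure, not just almost all of them.\<close>

definition cls :: "'i filter \<Rightarrow> 'm set \<Rightarrow> ('i \<Rightarrow> 'm) \<Rightarrow> ('i \<Rightarrow> 'm) set" where
  "cls U X g = {h. range h \<subseteq> X \<and> eventually (\<lambda>s. h s = g s) U}"

definition rep :: "('i \<Rightarrow> 'm) set \<Rightarrow> 'i \<Rightarrow> 'm" where
  "rep K = (SOME h. h \<in> K)"

definition ultrapower ::
    "'i filter \<Rightarrow> ('f, 'r, 'm) struct \<Rightarrow> ('f, 'r, ('i \<Rightarrow> 'm) set) struct" where
  "ultrapower U M =
     \<lparr> univ = {cls U (univ M) g | g. range g \<subseteq> univ M},
       fun_of = (\<lambda>f Ks. cls U (univ M) (\<lambda>s. fun_of M f (map (\<lambda>K. rep K s) Ks))),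
       rel_of = (\<lambda>r Ks. eventually (\<lambda>s. rel_of M r (map (\<lambda>K. rep K s) Ks)) U) \<rparr>"

lemma ultrapower_simps:
  "univ (ultrapower U M) = {cls U (univ M) g | g. range g \<subseteq> univ M}"
  "fun_of (ultrapower U M) f Ks = cls U (univ M) (\<lambda>s. fun_of M f (map (\<lambda>K. rep K s) Ks))"
  "rel_of (ultrapower U M) r Ks
    \<longleftrightarrow> eventually (\<lambda>s. rel_of M r (map (\<lambda>K. rep K s) Ks)) U"
  by (simp_all add: ultrapower_def)

lemma cls_cong:
  assumes "eventually (\<lambda>s. g s = h s) U"
  shows "cls U X g = cls U X h"
  using assms by (auto simp: cls_def elim: eventually_elim2)

lemma cls_eq_iff:
  assumes "range g \<subseteq> X" "range h \<subseteq> X"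
  shows "cls U X g = cls U X h \<longleftrightarrow> eventually (\<lambda>s. g s = h s) U"
proof
  assume eq: "cls U X g = cls U X h"
  have "g \<in> cls U X g" using assms by (simp add: cls_def)
  with eq show "eventually (\<lambda>s. g s = h s) U" by (simp add: cls_def)
qed (rule cls_cong)

lemma rep_cls:
  assumes "range g \<subseteq> X"
  shows "eventually (\<lambda>s. rep (cls U X g) s = g s) U"
proof -
  have "g \<in> cls U X g" using assms by (simp add: cls_def)
  then have "rep (cls U X g) \<in> cls U X g" unfolding rep_def by (metis someI_ex)
  then show ?thesis by (simp add: cls_def)
qed

lemma rep_cls_list:
  assumes "\<And>t. t \<in> set ts \<Longrightarrow> range (E t) \<subseteq> X"
  shows "eventually (\<lambda>s. map (\<lambda>K. rep K s) (map (\<lambda>t. cls U X (E t)) ts) = map (\<lambda>t. E t s) ts) U"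
proof -
  have "eventually (\<lambda>s. \<forall>t\<in>set ts. rep (cls U X (E t)) s = E t s) U"
    using assms by (intro eventually_ball_finite) (auto intro: rep_cls)
  then show ?thesis by (rule eventually_mono) simp
qed

lemma is_struct_nonempty: "is_struct L M \<Longrightarrow> univ M \<noteq> {}"
  by (simp add: is_struct_def)

lemma eval_in_univ:
  assumes "is_struct L M" "wf_trm L t" "range v \<subseteq> univ M"
  shows "eval M v t \<in> univ M"
  using assms(2)
proof (induction t)
  case (Fun f ts)
  then have "set (map (eval M v) ts) \<subseteq> univ M" by auto
  then show ?case using assms(1) Fun.prems by (simp add: is_struct_def)
qed (use assms(3) in auto)

lemma eval_ultrapower:
  assumes M: "is_struct L M" and "wf_trm L t" and g: "\<And>n s. g n s \<in> univ M"
  shows "eval (ultrapower U M) (\<lambda>n. cls U (univ M) (g n)) t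
    = cls U (univ M) (\<lambda>s. eval M (\<lambda>n. g n s) t)"
  using assms(2)
proof (induction t)
  case (Fun f ts)
  let ?E = "\<lambda>t s. eval M (\<lambda>n. g n s) t"
  have E: "range (?E t) \<subseteq> univ M" if "t \<in> set ts" for t
    using that Fun.prems g by (auto intro!: eval_in_univ[OF M])
  have ev: "eventually
      (\<lambda>s. map (\<lambda>K. rep K s) (map (\<lambda>t. cls U (univ M) (?E t)) ts) = map (\<lambda>t. ?E t s) ts) U"
    using E by (rule rep_cls_list)
  have "map (eval (ultrapower U M) (\<lambda>n. cls U (univ M) (g n))) ts
    = map (\<lambda>t. cls U (univ M) (?E t)) ts"
    using Fun by auto
  then have "eval (ultrapower U M) (\<lambda>n. cls U (univ M) (g n)) (Fun f ts)
    = cls U (univ M)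
        (\<lambda>s. fun_of M f (map (\<lambda>K. rep K s) (map (\<lambda>t. cls U (univ M) (?E t)) ts)))"
    by (simp only: eval.simps ultrapower_simps)
  also have "\<dots> = cls U (univ M) (\<lambda>s. fun_of M f (map (\<lambda>t. ?E t s) ts))"
    by (rule cls_cong, rule eventually_mono[OF ev]) (erule arg_cong)
  finally show ?case by simp
qed simp

text \<open>Changing the assignment at \<open>k\<close> amounts to changing the family \<open>g\<close> at \<open>k\<close>, both for the
  classes and at each index. This brings the quantifier steps into the form of the induction
  hypothesis.\<close>

lemma fun_upd_family:
  "(\<lambda>n. F (g n))(k := F h) = (\<lambda>n. F ((g(k := h)) n))"
  "(\<lambda>n. g n s)(k := h s) = (\<lambda>n. (g(k := h)) n s)"
  by auto

text \<open>Los's theorem, by induction on the formula. The connectives are handled by the ultrafilter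
  laws, the quantifiers by choosing an element of \<open>M\<close> at each index.\<close>

theorem Los:
  assumes U: "ultra U" and M: "is_struct L M"
    and "wf_fm L p" and "\<And>n s. g n s \<in> univ M"
  shows "sat (ultrapower U M) (\<lambda>n. cls U (univ M) (g n)) p
    \<longleftrightarrow> eventually (\<lambda>s. sat M (\<lambda>n. g n s) p) U"
  using assms(3,4)
proof (induction p arbitrary: g)
  case Bot
  then show ?case using U by (simp add: ultra_def)
next
  case (Eq t t')
  then have "range (\<lambda>s. eval M (\<lambda>n. g n s) t) \<subseteq> univ M"
    "range (\<lambda>s. eval M (\<lambda>n. g n s) t') \<subseteq> univ M"
    by (auto intro!: eval_in_univ[OF M])
  then show ?case using Eq by (simp add: eval_ultrapower[OF M] cls_eq_iff)
next
  case (Rel r ts)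
  let ?E = "\<lambda>t s. eval M (\<lambda>n. g n s) t"
  have E: "range (?E t) \<subseteq> univ M" if "t \<in> set ts" for t
    using that Rel by (auto intro!: eval_in_univ[OF M])
  have ev: "eventually
      (\<lambda>s. map (\<lambda>K. rep K s) (map (\<lambda>t. cls U (univ M) (?E t)) ts) = map (\<lambda>t. ?E t s) ts) U"
    using E by (rule rep_cls_list)
  have "map (eval (ultrapower U M) (\<lambda>n. cls U (univ M) (g n))) ts
    = map (\<lambda>t. cls U (univ M) (?E t)) ts"
    using Rel by (simp add: eval_ultrapower[OF M])
  then have "sat (ultrapower U M) (\<lambda>n. cls U (univ M) (g n)) (Rel r ts) \<longleftrightarrow>
    eventually
      (\<lambda>s. rel_of M r (map (\<lambda>K. rep K s) (map (\<lambda>t. cls U (univ M) (?E t)) ts))) U"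
    by (simp only: sat.simps ultrapower_simps)
  also have "\<dots> \<longleftrightarrow> eventually (\<lambda>s. rel_of M r (map (\<lambda>t. ?E t s) ts)) U"
    by (rule eventually_subst, rule eventually_mono[OF ev]) (erule arg_cong)
  finally show ?case by simp
next
  case (Conj p q)
  then show ?case by (simp add: eventually_conj_iff)
next
  case (Disj p q)
  then show ?case by (simp add: ultra_eventually_disj[OF U])
next
  case (Imp p q)
  then show ?case by (simp add: ultra_eventually_imp[OF U])
next
  case (Ex k p)
  have "sat (ultrapower U M) (\<lambda>n. cls U (univ M) (g n)) (Ex k p) \<longleftrightarrow>
    (\<exists>h. range h \<subseteq> univ M
      \<and> sat (ultrapower U M) ((\<lambda>n. cls U (univ M) (g n))(k := cls U (univ M) h)) p)"
    by (auto simp: ultrapower_simps)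
  also have "\<dots> \<longleftrightarrow>
    (\<exists>h. range h \<subseteq> univ M \<and> eventually (\<lambda>s. sat M ((\<lambda>n. g n s)(k := h s)) p) U)"
  proof -
    have "sat (ultrapower U M) ((\<lambda>n. cls U (univ M) (g n))(k := cls U (univ M) h)) p
      \<longleftrightarrow> eventually (\<lambda>s. sat M ((\<lambda>n. g n s)(k := h s)) p) U" if "range h \<subseteq> univ M" for h
      unfolding fun_upd_family by (rule Ex.IH) (use Ex.prems that in auto)
    then show ?thesis by blast
  qed
  also have "\<dots> \<longleftrightarrow> eventually (\<lambda>s. \<exists>m\<in>univ M. sat M ((\<lambda>n. g n s)(k := m)) p) U"
    using is_struct_nonempty[OF M] by (rule eventually_bex_iff[symmetric])
  finally show ?case by simp
next
  case (All k p)
  have "sat (ultrapower U M) (\<lambda>n. cls U (univ M) (g n)) (All k p) \<longleftrightarrow>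
    (\<forall>h. range h \<subseteq> univ M
      \<longrightarrow> sat (ultrapower U M) ((\<lambda>n. cls U (univ M) (g n))(k := cls U (univ M) h)) p)"
    by (auto simp: ultrapower_simps)
  also have "\<dots> \<longleftrightarrow>
    (\<forall>h. range h \<subseteq> univ M \<longrightarrow> eventually (\<lambda>s. sat M ((\<lambda>n. g n s)(k := h s)) p) U)"
  proof -
    have "sat (ultrapower U M) ((\<lambda>n. cls U (univ M) (g n))(k := cls U (univ M) h)) p
      \<longleftrightarrow> eventually (\<lambda>s. sat M ((\<lambda>n. g n s)(k := h s)) p) U" if "range h \<subseteq> univ M" for h
      unfolding fun_upd_family by (rule All.IH) (use All.prems that in auto)
    then show ?thesis by blast
  qed
  also have "\<dots> \<longleftrightarrow> eventually (\<lambda>s. \<forall>m\<in>univ M. sat M ((\<lambda>n. g n s)(k := m)) p) U"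
    using U is_struct_nonempty[OF M] by (rule ultra_eventually_ball_iff[symmetric])
  finally show ?case by simp
qed

lemma is_struct_ultrapower:
  assumes M: "is_struct L M"
  shows "is_struct L (ultrapower U M)"
  unfolding is_struct_def
proof (intro conjI ballI allI impI)
  obtain m where "m \<in> univ M" using M by (auto simp: is_struct_def)
  then show "univ (ultrapower U M) \<noteq> {}"
    by (auto simp: ultrapower_simps intro!: exI[of _ "\<lambda>_. m"])
next
  fix f Ks assume f: "f \<in> funs L" and Ks: "set Ks \<subseteq> univ (ultrapower U M)" "length Ks = farity L f"
  have "rep K s \<in> univ M" if "K \<in> set Ks" for K s
  proof -
    have "K \<in> univ (ultrapower U M)" using that Ks(1) by blast
    then obtain g where "K = cls U (univ M) g" "range g \<subseteq> univ M"
      unfolding ultrapower_simps by blast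
    then have "g \<in> K" by (simp add: cls_def)
    then have "rep K \<in> K" unfolding rep_def by (metis someI_ex)
    then show ?thesis using \<open>K = _\<close> by (auto simp: cls_def)
  qed
  then have "set (map (\<lambda>K. rep K s) Ks) \<subseteq> univ M" for s by auto
  then have "fun_of M f (map (\<lambda>K. rep K s) Ks) \<in> univ M" for s
    using M f Ks(2) by (simp add: is_struct_def)
  then show "fun_of (ultrapower U M) f Ks \<in> univ (ultrapower U M)"
    by (auto simp: ultrapower_simps)
qed

text \<open>The diagonal map into an ultrapower is elementary.\<close>

lemma sat_ultrapower_const:
  assumes "ultra U" "is_struct L M" "wf_fm L p" "range v \<subseteq> univ M"
  shows "sat (ultrapower U M) (\<lambda>n. cls U (univ M) (\<lambda>s. v n)) p \<longleftrightarrow> sat M v p"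
proof -
  have "U \<noteq> bot" using assms(1) by (simp add: ultra_def)
  then show ?thesis
    using assms(4) by (subst Los[OF assms(1-3)]) auto
qed

lemma satisfies_ultrapower:
  assumes "ultra U" "is_struct L M" "wf_fm L p" "satisfies M p"
  shows "satisfies (ultrapower U M) p"
  unfolding satisfies_def
proof (intro allI impI)
  fix v :: "nat \<Rightarrow> _" assume "range v \<subseteq> univ (ultrapower U M)"
  then have "\<forall>n. \<exists>g. range g \<subseteq> univ M \<and> v n = cls U (univ M) g"
    unfolding ultrapower_simps by blast
  then obtain g where g: "\<And>n. range (g n) \<subseteq> univ M" "\<And>n. v n = cls U (univ M) (g n)"
    by metis
  have g': "g n s \<in> univ M" for n s using g(1) by auto
  have v: "v = (\<lambda>n. cls U (univ M) (g n))" using g(2) by auto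
  have "range (\<lambda>n. g n s) \<subseteq> univ M" for s using g' by auto
  then have "sat M (\<lambda>n. g n s) p" for s
    using assms(4) by (simp add: satisfies_def)
  then show "sat (ultrapower U M) v p"
    unfolding v using Los[OF assms(1-3), of g] g' by simp
qed

section \<open>Finite parts of the diagram\<close>

text \<open>Finitely many pairs of a formula and an assignment have to be combined into one formula with one
  assignment. For this the variables of each formula are renamed so that a variable stands for the
  same element wherever it occurs; at the same time the formula is moved to a language with
  constants.\<close>

fun relabel_trm :: "(nat \<Rightarrow> nat) \<Rightarrow> 'f trm \<Rightarrow> ('f + 'a) trm" where
  "relabel_trm \<sigma> (Var n) = Var (\<sigma> n)"
| "relabel_trm \<sigma> (Fun f ts) = Fun (Inl f) (map (relabel_trm \<sigma>) ts)"

text \<open>Used for atomic formulas; the value on the others is a dummy, and for \<open>Bot\<close> it is the right one.\<close>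

fun relabel_atom :: "(nat \<Rightarrow> nat) \<Rightarrow> ('f, 'r) fm \<Rightarrow> ('f + 'a, 'r) fm" where
  "relabel_atom \<sigma> (Eq s t) = Eq (relabel_trm \<sigma> s) (relabel_trm \<sigma> t)"
| "relabel_atom \<sigma> (Rel r ts) = Rel r (map (relabel_trm \<sigma>) ts)"
| "relabel_atom \<sigma> _ = Bot"

lemma eval_relabel: "eval M v (relabel_trm \<sigma> t) = eval (reduct M) (v \<circ> \<sigma>) t"
  by (induction t) (simp_all add: reduct_def o_def cong: map_cong)

lemma sat_relabel:
  assumes "atomic p"
  shows "sat M v (relabel_atom \<sigma> p) \<longleftrightarrow> sat (reduct M) (v \<circ> \<sigma>) p"
proof (cases p)
  case (Rel r ts)
  then show ?thesis by (simp add: eval_relabel o_def) (simp add: reduct_def)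
qed (use assms in \<open>simp_all add: eval_relabel\<close>)

lemma wf_relabel_trm: "wf_trm L t \<Longrightarrow> wf_trm (expand_lang L A) (relabel_trm \<sigma> t)"
  by (induction t) (auto simp: expand_lang_def)

lemma wf_relabel:
  assumes "wf_fm L p" 
  shows "wf_fm (expand_lang L A) (relabel_atom \<sigma> p)"
  using assms by (cases p) (auto simp: wf_relabel_trm, auto simp: expand_lang_def)

lemma fv_relabel_trm: "fv_trm (relabel_trm \<sigma> t) = \<sigma> ` fv_trm t"
  by (induction t) auto

lemma fv_relabel: "fv (relabel_atom \<sigma> p) \<subseteq> \<sigma> ` fv p"
  by (cases p) (auto simp: fv_relabel_trm)

lemma atomic_relabel: "atomic (relabel_atom \<sigma> p)"
  by (cases p) auto

lemma eval_cong_fv: "(\<And>n. n \<in> fv_trm t \<Longrightarrow> v n = w n) \<Longrightarrow> eval M v t = eval M w t"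
proof (induction t)
  case (Fun f ts)
  then have "map (eval M v) ts = map (eval M w) ts" by auto
  then show ?case by (simp only: eval.simps)
qed simp

lemma sat_atomic_cong_fv:
  assumes "atomic p" "\<And>n. n \<in> fv p \<Longrightarrow> v n = w n"
  shows "sat M v p \<longleftrightarrow> sat M w p"
proof (cases p)
  case (Eq s t)
  then show ?thesis using assms eval_cong_fv[of s v w M] eval_cong_fv[of t v w M] by simp
next
  case (Rel r ts)
  then have "map (eval M v) ts = map (eval M w) ts"
    using assms by (auto intro!: eval_cong_fv)
  then show ?thesis using Rel by (simp only: sat.simps)
qed (use assms in auto)

lemma finite_fv_trm: "finite (fv_trm t)"
  by (induction t) auto

lemma finite_fv: "finite (fv p)"
  by (induction p) (auto simp: finite_fv_trm)

lemma atomic_quantifier_free: "atomic p \<Longrightarrow> quantifier_free p"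
  by (cases p) auto

text \<open>The empty conjunction is an equation that always holds, as there is no formula for truth. It
  contains the variable 0, which is why 0 is among the variables of the clauses below.\<close>

definition conjs :: "('f, 'r) fm list \<Rightarrow> ('f, 'r) fm" where
  "conjs ps = foldr Conj ps (Eq (Var 0) (Var 0))"

definition disjs :: "('f, 'r) fm list \<Rightarrow> ('f, 'r) fm" where
  "disjs ps = foldr Disj ps Bot"

lemma sat_conjs: "sat M v (conjs ps) \<longleftrightarrow> (\<forall>p\<in>set ps. sat M v p)"
  unfolding conjs_def by (induction ps) auto

lemma sat_disjs: "sat M v (disjs ps) \<longleftrightarrow> (\<exists>p\<in>set ps. sat M v p)"
  unfolding disjs_def by (induction ps) auto

lemma conjs_of_atoms:
  assumes "\<forall>p\<in>set ps. wf_fm L p \<and> atomic p \<and> fv p \<subseteq> X" "0 \<in> X"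
  shows "wf_fm L (conjs ps)" "positive (conjs ps)" "quantifier_free (conjs ps)"
    "fv (conjs ps) \<subseteq> X"
  using assms unfolding conjs_def
  by (induction ps) (auto intro: positive.intros atomic_quantifier_free)

lemma disjs_of_atoms:
  assumes "\<forall>p\<in>set ps. wf_fm L p \<and> atomic p \<and> fv p \<subseteq> X"
  shows "wf_fm L (disjs ps)" "positive (disjs ps)" "quantifier_free (disjs ps)"
    "fv (disjs ps) \<subseteq> X"
  using assms unfolding disjs_def
  by (induction ps) (auto intro: positive.intros atomic_quantifier_free)

text \<open>Satisfaction already quantifies over all assignments, so it does not see outer universal
  quantifiers.\<close>

lemma satisfies_alls:
  fixes p :: "('f, 'r) fm"
  shows "satisfies M (alls xs p) \<longleftrightarrow> satisfies M p"
proof (induction xs)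
  case (Cons x xs)
  have "satisfies M (All x q) \<longleftrightarrow> satisfies M q" for q :: "('f, 'r) fm"
  proof
    assume all: "satisfies M (All x q)"
    show "satisfies M q"
      unfolding satisfies_def
    proof (intro allI impI)
      fix v :: "nat \<Rightarrow> _" assume v: "range v \<subseteq> univ M"
      then have "sat M (v(x := v x)) q"
        using all unfolding satisfies_def sat.simps by blast
      then show "sat M v q" by simp
    qed
  next
    assume "satisfies M q"
    moreover have "range (v(x := m)) \<subseteq> univ M" if "range v \<subseteq> univ M" "m \<in> univ M" for v :: "nat \<Rightarrow> _" and m
      using that by auto
    ultimately show "satisfies M (All x q)"
      unfolding satisfies_def sat.simps by blast
  qed
  with Cons show ?case by simp
qed simp

lemma univ_expand_struct: "univ (expand_struct A) = univ A"
  by (simp add: expand_struct_def)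

text \<open>If no assignment into \<open>A\<close> makes \<open>P\<close> true and \<open>Q\<close> false, then the universal closure of
  \<open>\<And>P \<longrightarrow> \<Or>Q\<close> belongs to \<open>T_i L A\<close>, so it holds in \<open>C\<close>, which contradicts \<open>u\<close>.\<close>

lemma universal_clause_transfers:
  assumes C: "is_model (expand_lang L A) (T_i L A) C"
    and "finite P" "\<forall>p\<in>P. wf_fm (expand_lang L A) p \<and> atomic p"
    and "finite Q" "\<forall>q\<in>Q. wf_fm (expand_lang L A) q \<and> atomic q"
    and u: "range u \<subseteq> univ C" "\<forall>p\<in>P. sat C u p" "\<forall>q\<in>Q. \<not> sat C u q"
  shows "\<exists>v. range v \<subseteq> univ A \<and> (\<forall>p\<in>P. sat (expand_struct A) v p)
    \<and> (\<forall>q\<in>Q. \<not> sat (expand_struct A) v q)"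
proof (rule ccontr)
  assume none: "\<not> ?thesis"
  obtain ps qs where ps: "set ps = P" and qs: "set qs = Q"
    using assms by (meson finite_list)
  define X where "X = insert 0 (\<Union>p\<in>P \<union> Q. fv p)"
  have "finite X" using assms by (auto simp: X_def finite_fv)
  then obtain xs where xs: "set xs = X" "distinct xs" using finite_distinct_list by blast
  define \<theta> where "\<theta> = alls xs (Imp (exs [] (conjs ps)) (exs [] (disjs qs)))"
  have "h_inductive (expand_lang L A) \<theta>"
    unfolding \<theta>_def
  proof (rule h_inductive.basic)
    have P: "\<forall>p\<in>set ps. wf_fm (expand_lang L A) p \<and> atomic p \<and> fv p \<subseteq> X"
      and Q: "\<forall>p\<in>set qs. wf_fm (expand_lang L A) p \<and> atomic p \<and> fv p \<subseteq> X"
      using assms ps qs by (auto simp: X_def)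
    have "0 \<in> X" by (simp add: X_def)
    note conjs_of_atoms[OF P this] disjs_of_atoms[OF Q]
    then show "wf_fm (expand_lang L A) (conjs ps)" "positive (conjs ps)"
      "quantifier_free (conjs ps)" "fv (conjs ps) \<subseteq> set (xs @ [])"
      "wf_fm (expand_lang L A) (disjs qs)" "positive (disjs qs)"
      "quantifier_free (disjs qs)" "fv (disjs qs) \<subseteq> set (xs @ [])"
      by (simp_all add: xs)
  qed (use xs in auto)
  moreover have "satisfies (expand_struct A) \<theta>"
    unfolding \<theta>_def satisfies_alls
    using none by (fastforce simp: satisfies_def sat_conjs sat_disjs ps qs univ_expand_struct)
  ultimately have "satisfies C \<theta>"
    using C by (auto simp: is_model_def T_i_def)
  then have "sat C u (Imp (conjs ps) (disjs qs))"
    unfolding \<theta>_def satisfies_alls using u(1) by (simp add: satisfies_def)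
  then show False using u by (simp add: sat_conjs sat_disjs ps qs)
qed

text \<open>The finite part of the diagram of \<open>C\<close> given by \<open>S\<close> and \<open>A0\<close> is copied into \<open>A\<close> without moving
  the elements named by \<open>A0\<close>. Each of the finitely many elements \<open>c\<close> involved gets its own variable
  \<open>ix c\<close>, and the lemma above yields an assignment in \<open>A\<close> of these variables.\<close>

lemma finite_diagram_realised:
  fixes A :: "('f, 'r, 'a) struct" and C :: "('f + 'a, 'r, 'c) struct"
  assumes C: "is_model (expand_lang L A) (T_i L A) C"
    and S: "finite S" "\<And>p v. (p, v) \<in> S \<Longrightarrow> wf_fm L p \<and> atomic p \<and> range v \<subseteq> univ C"
    and A0: "finite A0" "A0 \<subseteq> univ A"
  shows "\<exists>w. range w \<subseteq> univ A
    \<and> (\<forall>(p, v)\<in>S. sat A (w \<circ> v) p \<longleftrightarrow> sat (reduct C) v p)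
    \<and> (\<forall>a\<in>A0. w (natural_map C a) = a)"
proof -
  have CS: "is_struct (expand_lang L A) C" using C by (simp add: is_model_def)
  obtain c0 where c0: "c0 \<in> univ C" using CS by (auto simp: is_struct_def)
  define E where "E = (\<Union>(p, v)\<in>S. v ` fv p) \<union> natural_map C ` A0"
  have "natural_map C a \<in> univ C" if "a \<in> univ A" for a
    using CS that by (auto simp: is_struct_def natural_map_def expand_lang_def)
  then have EC: "E \<subseteq> univ C" using S(2) A0(2) unfolding E_def by fast
  have "finite E" using S(1) A0(1) by (auto simp: E_def finite_fv)
  then obtain ix :: "'c \<Rightarrow> nat" where ix: "inj_on ix E"
    using finite_imp_inj_to_nat_seg by blast
  define u where "u k = (if k \<in> ix ` E then inv_into E ix k else c0)" for k
  have u_ix: "u (ix c) = c" if "c \<in> E" for c using that ix by (simp add: u_def)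
  have u: "range u \<subseteq> univ C"
    using EC c0 by (auto simp: u_def inv_into_into subset_iff)
  define atom where "atom = (\<lambda>(p :: ('f, 'r) fm, v). relabel_atom (ix \<circ> v) p :: ('f + 'a, 'r) fm)"
  \<comment> \<open>The equations \<open>name a\<close> force the variable of the interpretation of \<open>a\<close> in \<open>C\<close> to be sent to
    \<open>a\<close> in \<open>A\<close>.\<close>
  define name where
    "name a = (Eq (Var (ix (natural_map C a))) (Fun (Inr a) []) :: ('f + 'a, 'r) fm)" for a
  have atom_C: "sat C u (atom (p, v)) \<longleftrightarrow> sat (reduct C) v p" if "(p, v) \<in> S" for p v
  proof -
    have "atomic p" using that S(2) by blast
    moreover have "u (ix (v n)) = v n" if "n \<in> fv p" for n
      using u_ix that \<open>(p, v) \<in> S\<close> by (auto simp: E_def)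
    ultimately show ?thesis
      by (auto simp: atom_def sat_relabel intro!: sat_atomic_cong_fv)
  qed
  define P where "P = atom ` {x \<in> S. sat C u (atom x)} \<union> name ` A0"
  define Q where "Q = atom ` {x \<in> S. \<not> sat C u (atom x)}"
  have wf_atom: "wf_fm (expand_lang L A) (atom x) \<and> atomic (atom x)" if "x \<in> S" for x
    using that S(2) by (cases x) (auto simp: atom_def wf_relabel atomic_relabel)
  have wf_name: "wf_fm (expand_lang L A) (name a) \<and> atomic (name a)" if "a \<in> A0" for a
    using that A0(2) by (auto simp: name_def expand_lang_def)
  have name_C: "sat C u (name a)" if "a \<in> A0" for a
    using that u_ix by (simp add: name_def E_def) (simp add: natural_map_def)
  have "\<exists>v. range v \<subseteq> univ A \<and> (\<forall>p\<in>P. sat (expand_struct A) v p)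
    \<and> (\<forall>q\<in>Q. \<not> sat (expand_struct A) v q)"
  proof (rule universal_clause_transfers[OF C _ _ _ _ u])
    show "finite P" "finite Q" using S(1) A0(1) by (auto simp: P_def Q_def)
    show "\<forall>p\<in>P. wf_fm (expand_lang L A) p \<and> atomic p"
      "\<forall>q\<in>Q. wf_fm (expand_lang L A) q \<and> atomic q"
      using wf_atom wf_name unfolding P_def Q_def by blast+
    show "\<forall>p\<in>P. sat C u p" "\<forall>q\<in>Q. \<not> sat C u q"
      using name_C unfolding P_def Q_def by blast+
  qed
  then obtain v' where v': "range v' \<subseteq> univ A" "\<forall>p\<in>P. sat (expand_struct A) v' p"
    "\<forall>q\<in>Q. \<not> sat (expand_struct A) v' q" by blast
  have red: "reduct (expand_struct A) = A" by (simp add: reduct_def expand_struct_def)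
  have "sat A (v' \<circ> ix \<circ> v) p \<longleftrightarrow> sat (reduct C) v p" if "(p, v) \<in> S" for p v
  proof -
    have "sat A (v' \<circ> ix \<circ> v) p \<longleftrightarrow> sat (expand_struct A) v' (atom (p, v))"
      using that S(2) by (auto simp: atom_def sat_relabel red comp_assoc)
    also have "\<dots> \<longleftrightarrow> sat C u (atom (p, v))"
      using that v'(2,3) unfolding P_def Q_def by blast
    also have "\<dots> \<longleftrightarrow> sat (reduct C) v p" by (rule atom_C[OF that])
    finally show ?thesis .
  qed
  moreover have "v' (ix (natural_map C a)) = a" if "a \<in> A0" for a
  proof -
    have "sat (expand_struct A) v' (name a)" using that v'(2) by (simp add: P_def)
    then show ?thesis by (simp add: name_def expand_struct_def)
  qed
  ultimately show ?thesis
    using v'(1) by (intro exI[of _ "v' \<circ> ix"]) auto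
qed

section \<open>The amalgam\<close>

lemma h_inductive_wf:
  fixes p :: "('f, 'r) fm"
  shows "h_inductive L p \<Longrightarrow> wf_fm L p"
proof (induction rule: h_inductive.induct)
  case (basic xs ys zs \<psi> \<phi>)
  have "wf_fm L (exs ns q) = wf_fm L q" "wf_fm L (alls ns q) = wf_fm L q"
    for ns and q :: "('f, 'r) fm"
    by (induction ns) auto
  with basic show ?case by simp
qed simp

lemma is_struct_expand:
  "is_struct L B \<Longrightarrow> is_struct (expand_lang L B) (expand_struct B)"
  by (auto simp: is_struct_def expand_lang_def expand_struct_def)

text \<open>By this equation Los's theorem for \<open>L\<close> and \<open>B\<close> speaks about the reduct of the amalgam, while the
  amalgam itself is handled with the constants for \<open>B\<close> as part of the language.\<close>

lemma reduct_ultrapower_expand: "reduct (ultrapower U (expand_struct B)) = ultrapower U B"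
  by (simp add: reduct_def ultrapower_def expand_struct_def)

theorem lemma4:
  fixes L :: "('f, 'r) language"
    and A :: "('f, 'r, 'a) struct"
    and B :: "('f, 'r, 'b) struct"
    and C :: "('f + 'a, 'r, 'c) struct"
    and e :: "'a \<Rightarrow> 'b" and i :: "'a \<Rightarrow> 'c"
  assumes "is_struct L A" and "is_struct L B"
    and "is_model (expand_lang L A) (T_i L A) C"
    and "embedding L A B e"
    and "i = natural_map C"
  shows "\<exists>(D :: ('f + 'b, 'r, ('b, 'c) amalgam) struct)
            (e' :: 'c \<Rightarrow> ('b, 'c) amalgam) (i' :: 'b \<Rightarrow> ('b, 'c) amalgam).
           is_model (expand_lang L B) (T_i L B) D \<and>
           embedding L (reduct C) (reduct D) e' \<and>
           immersion L B (reduct D) i' \<and>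
           (\<forall>b\<in>univ B. i' b = natural_map D b) \<and>
           (\<forall>a\<in>univ A. i' (e a) = e' (i a))"
proof -
  note B = assms(2) and C = assms(3) and e = assms(4)
  obtain b0 where b0: "b0 \<in> univ B" using B by (auto simp: is_struct_def)
  \<comment> \<open>An index is an arbitrary map between the types, so its values may lie outside the universe of
    \<open>B\<close>; the retraction \<open>\<rho>\<close> corrects them and leaves maps into \<open>B\<close> unchanged.\<close>
  define \<rho> where "\<rho> b = (if b \<in> univ B then b else b0)" for b
  have \<rho>: "\<rho> b \<in> univ B" for b using b0 by (simp add: \<rho>_def)
  define G where "G = (\<lambda>(p, v :: nat \<Rightarrow> 'c). {s. sat B (\<rho> \<circ> s \<circ> v) p \<longleftrightarrow> sat (reduct C) v p})"
  define H where "H a = {s. \<rho> (s (i a)) = e a}" for a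
  define atoms where
    "atoms = {(p, v :: nat \<Rightarrow> 'c). wf_fm L p \<and> atomic p \<and> range v \<subseteq> univ C}"
  have "\<exists>U. ultra U \<and> (\<forall>X\<in>G ` atoms \<union> H ` univ A. eventually (\<lambda>s. s \<in> X) U)"
  proof (rule ultra_extending_subbase)
    fix \<X> assume "\<X> \<subseteq> G ` atoms \<union> H ` univ A" "finite \<X>"
    then obtain \<Y> \<Z> where "\<X> = \<Y> \<union> \<Z>" "finite \<Y>" "finite \<Z>" "\<Y> \<subseteq> G ` atoms" "\<Z> \<subseteq> H ` univ A"
      by (metis finite_Un subset_UnE)
    then obtain S A0 where S: "S \<subseteq> atoms" "finite S" and A0: "A0 \<subseteq> univ A" "finite A0"
      and \<X>: "\<X> = G ` S \<union> H ` A0"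
      by (metis finite_subset_image)
    have "\<exists>w. range w \<subseteq> univ A
      \<and> (\<forall>(p, v)\<in>S. sat A (w \<circ> v) p \<longleftrightarrow> sat (reduct C) v p)
      \<and> (\<forall>a\<in>A0. w (natural_map C a) = a)"
      by (rule finite_diagram_realised[OF C]) (use S A0 in \<open>auto simp: atoms_def\<close>)
    then obtain w where w: "range w \<subseteq> univ A"
      "\<And>p v. (p, v) \<in> S \<Longrightarrow> sat A (w \<circ> v) p \<longleftrightarrow> sat (reduct C) v p"
      "\<And>a. a \<in> A0 \<Longrightarrow> w (i a) = a"
      using assms(5) by blast
    have "e (w c) \<in> univ B" for c using e w(1) by (auto simp: embedding_def)
    then have ret: "\<rho> \<circ> (e \<circ> w) = e \<circ> w" by (auto simp: \<rho>_def)
    have "e \<circ> w \<in> G x" if "x \<in> S" for x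
    proof -
      obtain p v where x: "x = (p, v)" by force
      have "wf_fm L p" "atomic p" using that x S(1) by (auto simp: atoms_def)
      moreover have "range (w \<circ> v) \<subseteq> univ A" using w(1) by auto
      ultimately have "sat A (w \<circ> v) p \<longleftrightarrow> sat B (e \<circ> (w \<circ> v)) p"
        using e by (simp add: embedding_def)
      then show ?thesis
        using w(2)[of p v] that by (simp add: G_def x ret) (simp add: comp_assoc)
    qed
    moreover have "e \<circ> w \<in> H a" if "a \<in> A0" for a
      using fun_cong[OF ret, of "i a"] w(3)[OF that] by (simp add: H_def)
    ultimately show "\<Inter>\<X> \<noteq> {}" unfolding \<X> by blast
  qed
  then obtain U where U: "ultra U"
    and UX: "\<forall>X\<in>G ` atoms \<union> H ` univ A. eventually (\<lambda>s. s \<in> X) U"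
    by (elim exE conjE)
  have UG: "eventually (\<lambda>s. s \<in> G x) U" if "x \<in> atoms" for x
    by (rule bspec[OF UX]) (use that in simp)
  have UH: "eventually (\<lambda>s. s \<in> H a) U" if "a \<in> univ A" for a
    by (rule bspec[OF UX]) (use that in simp)
  define D where "D = ultrapower U (expand_struct B)"
  define e' where "e' c = cls U (univ B) (\<lambda>s. \<rho> (s c))" for c
  define i' where "i' b = cls U (univ B) (\<lambda>s. b)" for b
  have red: "reduct D = ultrapower U B" by (simp add: D_def reduct_ultrapower_expand)
  have "is_model (expand_lang L B) (T_i L B) D"
    unfolding is_model_def D_def
    using is_struct_expand[OF B] U
    by (auto simp: T_i_def intro: is_struct_ultrapower satisfies_ultrapower h_inductive_wf)
  moreover have "embedding L (reduct C) (reduct D) e'"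
    unfolding embedding_def red
  proof (intro conjI allI impI)
    show "e' ` univ (reduct C) \<subseteq> univ (ultrapower U B)"
      using \<rho> by (auto simp: e'_def ultrapower_simps)
  next
    fix p and v :: "nat \<Rightarrow> 'c"
    assume p: "wf_fm L p" "atomic p" and v: "range v \<subseteq> univ (reduct C)"
    have "(p, v) \<in> atoms" using p v by (simp add: atoms_def reduct_def)
    then have ev: "eventually (\<lambda>s. sat B (\<rho> \<circ> s \<circ> v) p \<longleftrightarrow> sat (reduct C) v p) U"
      using UG by (force simp: G_def)
    have "sat (ultrapower U B) (e' \<circ> v) p \<longleftrightarrow> eventually (\<lambda>s. sat B (\<rho> \<circ> s \<circ> v) p) U"
      using Los[OF U B p(1), of "\<lambda>n s. \<rho> (s (v n))"] \<rho> by (simp add: e'_def o_def)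
    also have "\<dots> \<longleftrightarrow> eventually (\<lambda>s. sat (reduct C) v p) U"
      by (rule eventually_subst[OF ev])
    also have "\<dots> \<longleftrightarrow> sat (reduct C) v p"
      using U by (auto simp: ultra_def)
    finally show "sat (reduct C) v p \<longleftrightarrow> sat (ultrapower U B) (e' \<circ> v) p" ..
  qed
  moreover have "immersion L B (reduct D) i'"
    unfolding immersion_def red
    using sat_ultrapower_const[OF U B]
    by (auto simp: i'_def ultrapower_simps o_def)
  moreover have "i' b = natural_map D b" for b
    by (simp add: i'_def D_def natural_map_def ultrapower_simps expand_struct_def)
  moreover have "i' (e a) = e' (i a)" if "a \<in> univ A" for a
    unfolding i'_def e'_def
    by (rule cls_cong, rule eventually_mono[OF UH[OF that]]) (simp add: H_def)
  ultimately show ?thesis by blast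
qed

end
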